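(* Let $m\ge1$, $n\ge m-1$ and $\lambda=(2m-1,2m-3,\dots,3,1)$. Then $$Q_\lambda(1,q,\dots,q^n)=2^mq^{\frac14\binom{2m}{3}}\prod_{i=1}^m\frac{(q^{n+1-m+i};q)_m}{(q;q^2)_{i-1}(q;q^2)_i}.$$
   Context: $q$ is a generic complex parameter: $q\neq 0$ and $q$ is not a root of unity. $(a;q)_k=(1-a)(1-aq)\cdots(1-aq^{k-1})$, so $(q;q^2)_i=(1-q)(1-q^3)\cdots(1-q^{2i-1})$. (The exponent $\frac14\binom{2m}3$ is an integer.) For a partition $\lambda_1\ge\dots\ge\lambda_m>0$ of length $m\le N$, the Schur $Q$-polynomial is the symmetric polynomial $$Q_\lambda(x_1,\dots,x_N)=2^m\sum_{\sigma\in S_N/S_{N-m}}\sigma\Bigg(x_1^{\lambda_1}\cdots x_m^{\lambda_m}\prod_{\substack{1\le i\le m\\ i<j\le N}}\frac{x_i+x_j}{x_i-x_j}\Bigg),$$ where $S_N$ acts by permuting the variables and $S_{N-m}$ is the subgroup permuting $x_{m+1},\dots,x_N$. Here $N=n+1$. *)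

theory Defs
  imports Complex_Main "HOL-Algebra.Sym_Groups" "HOL-Algebra.Left_Coset"
begin

definition q_poch :: "'a::comm_ring_1 \<Rightarrow> 'a \<Rightarrow> nat \<Rightarrow> 'a" where
  "q_poch a q k = (\<Prod>j<k. 1 - a * q ^ j)"

text \<open>
  The points x :: nat \<Rightarrow> 'a are used only at the indices 1..N, while lists are indexed from 0,
  so the i-th part of the partition is lam ! (i - 1).
\<close>

definition schur_Q_summand :: "nat list \<Rightarrow> nat \<Rightarrow> (nat \<Rightarrow> 'a::field) \<Rightarrow> 'a" where
  "schur_Q_summand lam N x =
     (\<Prod>i=1..length lam. x i ^ (lam ! (i - 1))) *
     (\<Prod>i=1..length lam. \<Prod>j=i+1..N. (x i + x j) / (x i - x j))"

text \<open>
  S_(N-m) as the subgroup of the symmetric group on 1..N that fixes 1..m pointwise.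
\<close>

definition tail_perms :: "nat \<Rightarrow> nat \<Rightarrow> (nat \<Rightarrow> nat) set" where
  "tail_perms m N = {\<tau>. \<tau> permutes {m+1..N}}"

text \<open>
  The value of the Schur Q-polynomial at the point (x 1, ..., x N). A permutation
  \<sigma> acts on a function f of N variables by (\<sigma> f) x = f (x \<circ> \<sigma>); the summand
  is invariant under S_(N-m), so the value does not depend on the representative picked from
  a coset (lemma schur_Q_summand_coset). The defining formula is a sum of rational functions
  and is evaluated pointwise: it gives the value of the polynomial wherever the
  denominators do not vanish, in particular if x 1, ..., x N are pairwise distinct. At points
  with repeated coordinates this definition is not meaningful.
\<close>

definition schur_Q :: "nat list \<Rightarrow> nat \<Rightarrow> (nat \<Rightarrow> 'a::field) \<Rightarrow> 'a" where
  "schur_Q lam N x = 2 ^ length lam *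
     (\<Sum>C \<in> lcosets\<^bsub>sym_group N\<^esub> (tail_perms (length lam) N).
        schur_Q_summand lam N (x \<circ> (SOME \<sigma>. \<sigma> \<in> C)))"

lemma schur_Q_summand_tail:
  assumes "\<tau> \<in> tail_perms (length lam) N"
  shows "schur_Q_summand lam N (x \<circ> \<tau>) = schur_Q_summand lam N x"
proof -
  let ?m = "length lam"
  have p: "\<tau> permutes {?m+1..N}" using assms by (simp add: tail_perms_def)
  have fixed: "\<tau> i = i" if "i \<le> ?m" for i
    using permutes_not_in[OF p] that by auto
  have "(\<Prod>j=i+1..N. (x i + x (\<tau> j)) / (x i - x (\<tau> j))) =
        (\<Prod>j=i+1..N. (x i + x j) / (x i - x j))" if "i \<le> ?m" for i
  proof -
    have "\<tau> permutes {i+1..N}"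
      by (rule permutes_subset[OF p]) (use that in auto)
    from prod.permute[OF this, of "\<lambda>j. (x i + x j) / (x i - x j)"]
    show ?thesis by (simp add: o_def)
  qed
  then show ?thesis
    unfolding schur_Q_summand_def by (simp add: fixed)
qed

lemma schur_Q_summand_coset:
  assumes "C \<in> lcosets\<^bsub>sym_group N\<^esub> (tail_perms (length lam) N)" "\<sigma> \<in> C" "\<rho> \<in> C"
  shows "schur_Q_summand lam N (x \<circ> \<sigma>) = schur_Q_summand lam N (x \<circ> \<rho>)"
proof -
  obtain a where "C = a <#\<^bsub>sym_group N\<^esub> (tail_perms (length lam) N)"
    using assms(1) by (auto simp: LCOSETS_def)
  then have "schur_Q_summand lam N (x \<circ> \<pi>) = schur_Q_summand lam N (x \<circ> a)" if "\<pi> \<in> C" for \<pi>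
    using that schur_Q_summand_tail[of _ lam N "x \<circ> a"]
    by (auto simp: l_coset_def sym_group_mult o_assoc)
  then show ?thesis using assms by metis
qed

lemma tail_perms_subgroup: "subgroup (tail_perms m N) (sym_group N)"
proof
  show "tail_perms m N \<subseteq> carrier (sym_group N)"
  proof
    fix p assume "p \<in> tail_perms m N"
    then have "p permutes {m+1..N}" by (simp add: tail_perms_def)
    then have "p permutes {1..N}" by (rule permutes_subset) auto
    then show "p \<in> carrier (sym_group N)" by (simp add: sym_group_carrier)
  qed
next
  fix x y assume "x \<in> tail_perms m N" "y \<in> tail_perms m N"
  then show "x \<otimes>\<^bsub>sym_group N\<^esub> y \<in> tail_perms m N"
    by (simp add: tail_perms_def sym_group_mult permutes_compose)
next
  show "\<one>\<^bsub>sym_group N\<^esub> \<in> tail_perms m N"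
    by (simp add: tail_perms_def sym_group_one permutes_id)
next
  fix x assume x: "x \<in> tail_perms m N"
  then have p: "x permutes {m+1..N}" by (simp add: tail_perms_def)
  then have xc: "x permutes {1..N}" by (rule permutes_subset) auto
  interpret group "sym_group N" by (rule sym_group_is_group)
  have "inv\<^bsub>sym_group N\<^esub> x = inv' x"
    by (rule inv_equality)
       (use xc permutes_inv[OF xc] in
         \<open>auto simp: sym_group_mult sym_group_one sym_group_carrier permutes_inv_o\<close>)
  then show "inv\<^bsub>sym_group N\<^esub> x \<in> tail_perms m N"
    using permutes_inv[OF p] by (simp add: tail_perms_def)
qed

text \<open>The division by 4 in the exponent of q is exact.\<close>

lemma four_dvd_choose: "4 dvd ((2 * m) choose 3)"
proof -
  have two: "2 * ((2 * k) choose 2) + 2 * k = 4 * k ^ 2" for k :: nat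
    by (cases k) (simp_all add: choose_two power2_eq_square algebra_simps)
  have "(2 * m) choose 3 = 4 * (\<Sum>k<m. k ^ 2)"
  proof (induction m)
    case (Suc m)
    have "(2 * Suc m) choose 3 = ((2 * m) choose 3) + (2 * ((2 * m) choose 2) + 2 * m)"
      by (simp add: numeral_3_eq_3 numeral_2_eq_2)
    then show ?case using Suc two[of m] by simp
  qed simp
  then show ?thesis by simp
qed

end

theory Submission
  imports Defs "Jordan_Normal_Form.Determinant" "HOL-Computational_Algebra.Formal_Power_Series"
begin

text \<open>
  Write \<open>w\<^sub>k\<close> for the product of \<open>(x\<^sub>k + x\<^sub>j) / (x\<^sub>k - x\<^sub>j)\<close> over all \<open>j \<noteq> k\<close>. The sum over
  cosets that defines \<open>Q\<^sub>\<lambda>\<close> is a sum over tuples of distinct indices, and in the term of a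
  tuple the factors that lead out of the tuple are the \<open>w\<close> of its entries, divided by the
  factors inside the tuple. What remains inside, the product of \<open>(x\<^sub>a - x\<^sub>b) / (x\<^sub>a + x\<^sub>b)\<close>, changes
  sign under transpositions and vanishes on repeated indices
  (lemma \<open>schur_Q_eq_sum_tuples\<close>). So the monomial may be antisymmetrized. For the parts
  \<open>1, 3, \<dots>, 2m-1\<close> it turns into the product of the variables times a Vandermonde determinant in
  their squares, which cancels the denominators: the sum becomes that of the product of the
  \<open>w x\<close> times a squared Vandermonde determinant \<open>V\<^sup>2\<close>. By Andreief's identity this is, up to
  sign, a Hankel determinant of the functional \<open>L f = \<Sum>\<^sub>k w\<^sub>k x\<^sub>k f(x\<^sub>k)\<close>, and it may be computed in
  any two bases of polynomials of degrees \<open>0, \<dots>, m-1\<close> (lemma \<open>odd_staircase_sum_eq_det\<close>).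

  At \<open>x = 1, q, \<dots>, q\<^sup>n\<close> the weight \<open>w\<close> is of q-Hahn type,
  \<open>(-1)\<^sup>k (-q)\<^sub>k (-q)\<^bsub>n-k\<^esub> / ((q)\<^sub>k (q)\<^bsub>n-k\<^esub>)\<close>. The products of the factors \<open>X + q\<^bsup>n+1+s\<^esup>\<close>, respectively
  \<open>1 + q\<^bsup>s+1\<^esup> X\<close>, only lengthen the two q-factorials in the numerator, hence
  all entries of the determinant are q-Chu-Vandermonde sums (lemma \<open>q_hahn_moment\<close>). There
  remains the determinant of \<open>(q\<^bsup>i+j+2\<^esup>; q)\<^sub>n\<close>. Its rows are, up to factors, the values at \<open>q\<^sup>i\<close> of
  \<open>m\<close> polynomials of degree below \<open>m\<close>. Such a determinant is the Vandermonde determinant of the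
  points times a constant, and the constant is found at other points, where the
  matrix is triangular (lemma \<open>det_shifted_q_poch\<close>). The two signs
  \<open>(-1)\<^bsup>m choose 2\<^esup>\<close>, from the reversed differences in \<open>V\<close> and from this change of points, cancel, and
  the remaining q-factorials telescope (lemma \<open>prod_qfac_window\<close>).
\<close>

section \<open>Alternants\<close>

text \<open>
  The points need not be scalars: below they are indices of variables, and \<open>f j\<close> is then a
  function of the index.
\<close>

definition alternant :: "nat \<Rightarrow> (nat \<Rightarrow> 'b \<Rightarrow> 'a::comm_ring_1) \<Rightarrow> (nat \<Rightarrow> 'b) \<Rightarrow> 'a" where
  "alternant m f x = det (mat m m (\<lambda>(i, j). f j (x i)))"

lemma alternant_leibniz_cols:
  "alternant m f x =
     (\<Sum>p | p permutes {0..<m}. signof p * (\<Prod>i=0..<m. f (p i) (x i)))"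
  unfolding alternant_def
  by (subst det_def'[of _ m]) (auto intro!: sum.cong prod.cong simp: permutes_in_image)

lemma alternant_leibniz_rows:
  "alternant m f x =
     (\<Sum>p | p permutes {0..<m}. signof p * (\<Prod>i=0..<m. f i (x (p i))))"
proof -
  have "alternant m f x = det (transpose_mat (mat m m (\<lambda>(i, j). f j (x i))))"
    unfolding alternant_def by (rule det_transpose[of _ m, symmetric]) simp
  also have "\<dots> = (\<Sum>p | p permutes {0..<m}. signof p * (\<Prod>i=0..<m. f i (x (p i))))"
    by (subst det_def'[of _ m]) (auto intro!: sum.cong prod.cong simp: permutes_in_image)
  finally show ?thesis .
qed

lemma alternant_permute:
  assumes "p permutes {0..<m}"
  shows "alternant m f (x \<circ> p) = signof p * alternant m f x"
proof -
  have "mat m m (\<lambda>(i, j). mat m m (\<lambda>(i, j). f j (x i)) $$ (p i, j)) =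
        mat m m (\<lambda>(i, j). f j ((x \<circ> p) i))"
    using assms by (auto simp: permutes_in_image intro!: eq_matI)
  with det_permute_rows[OF _ assms, of "mat m m (\<lambda>(i, j). f j (x i))"]
  show ?thesis unfolding alternant_def by simp
qed

lemma alternant_scale:
  "alternant m (\<lambda>j a. c a * f j a) x = (\<Prod>i=0..<m. c (x i)) * alternant m f x"
  unfolding alternant_leibniz_cols
  by (auto simp: prod.distrib sum_distrib_left mult_ac intro!: sum.cong)

lemma det_scale_rows_cols:
  fixes u v :: "nat \<Rightarrow> 'a::comm_ring_1"
  shows "det (mat m m (\<lambda>(i, j). u i * v j * F i j)) =
    (\<Prod>i<m. u i) * (\<Prod>j<m. v j) * det (mat m m (\<lambda>(i, j). F i j))"
proof -
  have v: "(\<Prod>i<m. v (p i)) = (\<Prod>j<m. v j)" if "p permutes {..<m}" for p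
    using prod.permute[OF that, of v] by (simp add: o_def)
  have "det (mat m m (\<lambda>(i, j). u i * v j * F i j)) =
      (\<Sum>p | p permutes {0..<m}. signof p * (\<Prod>i=0..<m. u i * v (p i) * F i (p i)))"
    by (subst det_def'[of _ m]) (auto intro!: sum.cong prod.cong simp: permutes_in_image)
  also have "\<dots> = (\<Prod>i<m. u i) * (\<Prod>j<m. v j) *
      (\<Sum>p | p permutes {0..<m}. signof p * (\<Prod>i=0..<m. F i (p i)))"
    by (auto simp: sum_distrib_left prod.distrib v atLeast0LessThan mult_ac intro!: sum.cong)
  also have "(\<Sum>p | p permutes {0..<m}. signof p * (\<Prod>i=0..<m. F i (p i))) =
      det (mat m m (\<lambda>(i, j). F i j))"
    by (subst det_def'[of _ m]) (auto intro!: sum.cong prod.cong simp: permutes_in_image)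
  finally show ?thesis .
qed

text \<open>
  A function \<open>\<Phi>\<close> that changes sign under transpositions sees only the antisymmetric part of what
  it is summed against. The tuples are not required to be injective, which keeps the domain a
  full product, over which sums of products factor.
\<close>

lemma sum_antisymmetrize:
  fixes g :: "nat \<Rightarrow> 'b \<Rightarrow> 'a::field_char_0" and \<Phi> :: "(nat \<Rightarrow> 'b) \<Rightarrow> 'a"
  assumes \<Phi>: "\<And>p t. p permutes {0..<m} \<Longrightarrow> \<Phi> (t \<circ> p) = signof p * \<Phi> t"
  shows "(\<Sum>t \<in> {0..<m} \<rightarrow>\<^sub>E A. alternant m g t * \<Phi> t) =
         fact m * (\<Sum>t \<in> {0..<m} \<rightarrow>\<^sub>E A. (\<Prod>i=0..<m. g i (t i)) * \<Phi> t)"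
proof -
  let ?T = "{0..<m} \<rightarrow>\<^sub>E A" and ?P = "{p. p permutes {0..<m}}"
  define G where "G t = (\<Prod>i=0..<m. g i (t i)) * \<Phi> t" for t
  have G: "(\<Sum>t\<in>?T. G (t \<circ> p)) = (\<Sum>t\<in>?T. G t)" if p: "p permutes {0..<m}" for p
  proof (rule sum.reindex_bij_witness[of _ "\<lambda>t. t \<circ> inv' p" "\<lambda>t. t \<circ> p"])
    have closed: "t \<circ> r \<in> ?T" if "t \<in> ?T" "r permutes {0..<m}" for t r
    proof (rule PiE_I)
      fix i assume "i \<in> {0..<m}"
      then have "r i \<in> {0..<m}" using permutes_in_image[OF that(2)] by blast
      then show "(t \<circ> r) i \<in> A" using that(1) by (auto simp: PiE_iff)
    next
      fix i assume "i \<notin> {0..<m}"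
      then show "(t \<circ> r) i = undefined"
        using that(1) permutes_not_in[OF that(2)] by (auto simp: PiE_iff extensional_def)
    qed
    show "t \<circ> p \<in> ?T" "t \<circ> inv' p \<in> ?T" if "t \<in> ?T" for t
      using closed that p permutes_inv[OF p] by auto
    show "t \<circ> p \<circ> inv' p = t" "t \<circ> inv' p \<circ> p = t" for t :: "nat \<Rightarrow> 'b"
      by (simp_all add: fun_eq_iff permutes_inverses[OF p])
  qed auto
  have "(\<Sum>t\<in>?T. alternant m g t * \<Phi> t) = (\<Sum>t\<in>?T. \<Sum>p\<in>?P. G (t \<circ> p))"
    unfolding alternant_leibniz_rows G_def
    by (auto simp: sum_distrib_right sum_distrib_left \<Phi> mult_ac intro!: sum.cong)
  also have "\<dots> = (\<Sum>p\<in>?P. \<Sum>t\<in>?T. G (t \<circ> p))" by (rule sum.swap)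
  also have "\<dots> = (\<Sum>p\<in>?P. \<Sum>t\<in>?T. G t)" by (rule sum.cong) (auto simp: G)
  also have "\<dots> = fact m * (\<Sum>t\<in>?T. G t)"
    using card_permutations[of "{0..<m}" m] by simp
  finally show ?thesis by (simp add: G_def)
qed

text \<open>
  Andreief's identity, the Cauchy-Binet formula with unordered tuples. One of the two determinants is
  traded for its diagonal term by antisymmetry of the other one; then the sum over tuples
  factors.
\<close>

lemma andreief:
  fixes g f :: "nat \<Rightarrow> 'b \<Rightarrow> 'a::field_char_0"
  assumes "finite A"
  shows "(\<Sum>t \<in> {0..<m} \<rightarrow>\<^sub>E A. alternant m g t * alternant m f t) =
         fact m * det (mat m m (\<lambda>(i, j). \<Sum>a\<in>A. g i a * f j a))"
proof -
  let ?T = "{0..<m} \<rightarrow>\<^sub>E A" and ?P = "{p. p permutes {0..<m}}"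
  have "(\<Sum>t\<in>?T. (\<Prod>i=0..<m. g i (t i)) * alternant m f t) =
        (\<Sum>t\<in>?T. \<Sum>p\<in>?P. signof p * (\<Prod>i=0..<m. g i (t i) * f (p i) (t i)))"
    unfolding alternant_leibniz_cols
    by (auto simp: sum_distrib_left prod.distrib mult_ac intro!: sum.cong)
  also have "\<dots> = (\<Sum>p\<in>?P. signof p * (\<Sum>t\<in>?T. \<Prod>i=0..<m. g i (t i) * f (p i) (t i)))"
    by (subst sum.swap) (simp add: sum_distrib_left)
  also have "\<dots> = (\<Sum>p\<in>?P. signof p * (\<Prod>i=0..<m. \<Sum>a\<in>A. g i a * f (p i) a))"
    using assms by (subst prod_sum_PiE) auto
  also have "\<dots> = det (mat m m (\<lambda>(i, j). \<Sum>a\<in>A. g i a * f j a))"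
    by (subst det_def'[of _ m]) (auto intro!: sum.cong prod.cong simp: permutes_in_image)
  finally show ?thesis
    using sum_antisymmetrize[of m "alternant m f" g A] by (simp add: alternant_permute)
qed

text \<open>
  The dependence on the points and on the polynomials separates, since expanding polynomials in
  monomials is a product of matrices. The second factor can therefore be computed at
  any convenient points.
\<close>

lemma alternant_poly:
  fixes x :: "nat \<Rightarrow> 'a::comm_ring_1"
  assumes "\<And>j. j < m \<Longrightarrow> degree (f j) < m"
  shows "alternant m (\<lambda>j. poly (f j)) x =
         alternant m (\<lambda>j z. z ^ j) x * det (mat m m (\<lambda>(i, j). coeff (f j) i))"
proof -
  have "poly (f j) z = (\<Sum>k=0..<m. z ^ k * coeff (f j) k)" if "j < m" for j z
  proof -
    have "poly (f j) z = (\<Sum>k\<le>degree (f j). coeff (f j) k * z ^ k)" by (rule poly_altdef)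
    also have "\<dots> = (\<Sum>k=0..<m. coeff (f j) k * z ^ k)"
      using assms[OF that] by (intro sum.mono_neutral_left) (auto simp: coeff_eq_0)
    finally show ?thesis by (simp add: mult.commute)
  qed
  then have "mat m m (\<lambda>(i, j). poly (f j) (x i)) =
        mat m m (\<lambda>(i, j). x i ^ j) * mat m m (\<lambda>(i, j). coeff (f j) i)"
    by (intro eq_matI) (auto simp: scalar_prod_def)
  then show ?thesis
    unfolding alternant_def by (simp add: det_mult[of _ m])
qed

lemma alternant_lower_triangular:
  fixes f :: "nat \<Rightarrow> 'b \<Rightarrow> 'a::idom"
  assumes "\<And>i j. i < j \<Longrightarrow> j < m \<Longrightarrow> f j (x i) = 0"
  shows "alternant m f x = (\<Prod>i<m. f i (x i))"
proof -
  have "alternant m f x = prod_list (diag_mat (mat m m (\<lambda>(i, j). f j (x i))))"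
    unfolding alternant_def using assms by (intro det_lower_triangular[of m]) auto
  then show ?thesis by (simp add: prod_list_diag_prod atLeast0LessThan)
qed

lemma alternant_upper_triangular:
  fixes f :: "nat \<Rightarrow> 'b \<Rightarrow> 'a::idom"
  assumes "\<And>i j. j < i \<Longrightarrow> i < m \<Longrightarrow> f j (x i) = 0"
  shows "alternant m f x = (\<Prod>i<m. f i (x i))"
proof -
  have "alternant m f x = prod_list (diag_mat (mat m m (\<lambda>(i, j). f j (x i))))"
    unfolding alternant_def using assms
    by (intro det_upper_triangular[of _ m]) (auto simp: upper_triangular_def)
  then show ?thesis by (simp add: prod_list_diag_prod atLeast0LessThan)
qed

lemma alternant_poly_triangular:
  fixes x :: "nat \<Rightarrow> 'a::idom"
  assumes "\<And>j. j < m \<Longrightarrow> degree (f j) \<le> j"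
  shows "alternant m (\<lambda>j. poly (f j)) x =
         alternant m (\<lambda>j z. z ^ j) x * (\<Prod>j<m. coeff (f j) j)"
proof -
  have "alternant m (\<lambda>j. coeff (f j)) id = (\<Prod>j<m. coeff (f j) j)"
    by (subst alternant_upper_triangular)
       (auto intro!: coeff_eq_0 intro: le_less_trans[OF assms])
  moreover have "degree (f j) < m" if "j < m" for j
    using assms[OF that] that by simp
  ultimately show ?thesis using alternant_poly[of m f x] by (simp add: alternant_def)
qed

lemma degree_coeff_prod_linear:
  fixes a b :: "nat \<Rightarrow> 'a::comm_ring_1"
  shows "degree (\<Prod>s<j. [:a s, b s:]) \<le> j"
    and "coeff (\<Prod>s<j. [:a s, b s:]) j = (\<Prod>s<j. b s)"
proof -
  have "degree (\<Prod>s<j. [:a s, b s:]) \<le> j \<and>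
        coeff (\<Prod>s<j. [:a s, b s:]) j = (\<Prod>s<j. b s)"
  proof (induction j)
    case (Suc j)
    let ?p = "\<Prod>s<j. [:a s, b s:]"
    have "degree (?p * [:a j, b j:]) \<le> degree ?p + degree [:a j, b j:]"
      by (rule degree_mult_le)
    also have "\<dots> \<le> Suc j" using Suc by simp
    finally show ?case using Suc by (simp add: coeff_eq_0 mult.commute)
  qed simp
  then show "degree (\<Prod>s<j. [:a s, b s:]) \<le> j"
    and "coeff (\<Prod>s<j. [:a s, b s:]) j = (\<Prod>s<j. b s)" by auto
qed

text \<open>
  In the Newton basis, whose \<open>j\<close>-th member vanishes at the points before the \<open>j\<close>-th, the
  matrix is triangular.
\<close>

lemma vandermonde:
  fixes x :: "nat \<Rightarrow> 'a::idom"
  shows "alternant m (\<lambda>j z. z ^ j) x = (\<Prod>b<m. \<Prod>a<b. x b - x a)"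
proof -
  let ?N = "\<lambda>j. \<Prod>s<j. [:- x s, 1:]"
  have "alternant m (\<lambda>j z. z ^ j) x = alternant m (\<lambda>j. poly (?N j)) x"
    by (subst alternant_poly_triangular) (auto simp: degree_coeff_prod_linear)
  also have "\<dots> = alternant m (\<lambda>j z. \<Prod>s<j. z - x s) x"
    by (simp add: alternant_def poly_prod)
  also have "\<dots> = (\<Prod>b<m. \<Prod>a<b. x b - x a)"
    by (rule alternant_lower_triangular) auto
  finally show ?thesis .
qed

text \<open>
  Here \<open>(u - v) / (u + v) = (u - v)\<^sup>2 / (u\<^sup>2 - v\<^sup>2)\<close>. In this form the antisymmetry of the left side
  is evident: the square is symmetric and the denominator is an alternant. At repeated
  points both sides are \<open>0\<close>.
\<close>

lemma prod_skew_quotients_as_alternants: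
  fixes y :: "'b \<Rightarrow> 'a::field"
  shows "(\<Prod>b<m. \<Prod>a<b. (y (t b) - y (t a)) / (y (t b) + y (t a))) =
         alternant m (\<lambda>j a. y a ^ j) t ^ 2 / alternant m (\<lambda>j a. (y a ^ 2) ^ j) t"
proof -
  have V: "alternant m (\<lambda>j a. h a ^ j) t = (\<Prod>b<m. \<Prod>a<b. h (t b) - h (t a))"
    for h :: "'b \<Rightarrow> 'a"
    using vandermonde[of m "\<lambda>i. h (t i)"] by (simp add: alternant_def)
  have "(u - v) / (u + v) = (u - v) ^ 2 / (u ^ 2 - v ^ 2)" for u v :: 'a
    by (cases "u = v") (simp_all add: power2_eq_square square_diff_square_factored)
  then show ?thesis
    by (simp add: V prod_dividef prod_power_distrib)
qed

text \<open>
  Antisymmetrizing the odd powers \<open>y\<^bsup>2i+1\<^esup>\<close> gives \<open>V(y\<^sup>2)\<close> times the product of the \<open>y\<close>, and \<open>V(y\<^sup>2)\<close> is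
  the denominator of the skew factor \<open>V(y)\<^sup>2 / V(y\<^sup>2)\<close>. So \<open>m!\<close> times the sum on the left is the sum of
  \<open>V(y)\<^sup>2\<close> against the weights \<open>c y\<close>, to which Andreief's identity applies. The two families
  of polynomials are free: they enter only through their leading coefficients, and are chosen later
  so that the entries can be summed.
\<close>

lemma odd_staircase_sum_eq_det:
  fixes y c :: "'b \<Rightarrow> 'a::field_char_0" and P R :: "nat \<Rightarrow> 'a poly"
  assumes fin: "finite A"
    and nz: "\<And>a b. a \<in> A \<Longrightarrow> b \<in> A \<Longrightarrow> y a + y b \<noteq> 0"
    and P: "\<And>j. j < m \<Longrightarrow> degree (P j) \<le> j" and R: "\<And>j. j < m \<Longrightarrow> degree (R j) \<le> j"
  shows "(\<Sum>t \<in> {0..<m} \<rightarrow>\<^sub>E A. (\<Prod>i=0..<m. c (t i) * y (t i) ^ (2 * i + 1)) *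
            (\<Prod>b<m. \<Prod>a<b. (y (t b) - y (t a)) / (y (t b) + y (t a)))) *
          ((\<Prod>j<m. coeff (P j) j) * (\<Prod>j<m. coeff (R j) j)) =
         det (mat m m (\<lambda>(i, j). \<Sum>a\<in>A. c a * y a * poly (P i) (y a) * poly (R j) (y a)))"
    (is "?S * ?lead = ?D")
proof -
  let ?T = "{0..<m} \<rightarrow>\<^sub>E A"
  define V where "V = alternant m (\<lambda>j a. y a ^ j)"
  define V2 where "V2 = alternant m (\<lambda>j a. (y a ^ 2) ^ j)"
  define W where "W t = (\<Prod>i=0..<m. c (t i) * y (t i))" for t
  define \<Phi> where "\<Phi> t = V t ^ 2 / V2 t" for t
  have anti: "\<Phi> (t \<circ> p) = signof p * \<Phi> t" if "p permutes {0..<m}" for p t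
    using that by (auto simp: \<Phi>_def V_def V2_def alternant_permute sign_def)
  have alt_y: "alternant m (\<lambda>j a. poly (f j) (y a)) t = V t * (\<Prod>j<m. coeff (f j) j)"
    if "\<And>j. j < m \<Longrightarrow> degree (f j) \<le> j" for f t
    using alternant_poly_triangular[of m f "\<lambda>i. y (t i)", OF that]
    by (simp add: alternant_def V_def)
  \<comment> \<open>If \<open>V2 t = 0\<close> then two of the squares agree, hence two of the \<open>y\<close>, as no two of them
      have sum \<open>0\<close>. So \<open>V t = 0\<close> as well, and nothing is lost by the division by \<open>0\<close>.\<close>
  have sq: "W t * V2 t * \<Phi> t = W t * V t ^ 2" if "t \<in> ?T" for t
  proof (cases "V2 t = 0")
    case True
    then obtain a b where "a < b" "b < m" "y (t b) ^ 2 = y (t a) ^ 2"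
      using vandermonde[of m "\<lambda>i. y (t i) ^ 2"] by (auto simp: V2_def alternant_def)
    moreover have "t a \<in> A" "t b \<in> A" using that calculation by (auto simp: PiE_iff)
    ultimately have "y (t b) = y (t a)"
      using nz[of "t a" "t b"] by (auto simp: power2_eq_iff)
    then have "V t = 0"
      using vandermonde[of m "\<lambda>i. y (t i)"] \<open>a < b\<close> \<open>b < m\<close>
      by (force simp: V_def alternant_def)
    then show ?thesis by (simp add: \<Phi>_def)
  qed (simp add: \<Phi>_def)
  have "fact m * ?S = fact m * (\<Sum>t\<in>?T. (\<Prod>i=0..<m. c (t i) * y (t i) * (y (t i) ^ 2) ^ i) * \<Phi> t)"
    unfolding \<Phi>_def V_def V2_def prod_skew_quotients_as_alternants[symmetric]
    by (simp add: power_mult[symmetric] mult_ac)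
  also have "\<dots> = (\<Sum>t\<in>?T. alternant m (\<lambda>j a. c a * y a * (y a ^ 2) ^ j) t * \<Phi> t)"
    by (rule sum_antisymmetrize[symmetric]) (rule anti)
  also have "\<dots> = (\<Sum>t\<in>?T. W t * V t ^ 2)"
    by (rule sum.cong) (use sq in \<open>auto simp: alternant_scale W_def V2_def\<close>)
  finally have S: "fact m * ?S = (\<Sum>t\<in>?T. W t * V t ^ 2)" .
  have "fact m * ?D = (\<Sum>t\<in>?T. alternant m (\<lambda>i a. c a * y a * poly (P i) (y a)) t *
                          alternant m (\<lambda>j a. poly (R j) (y a)) t)"
    by (rule andreief[OF fin, symmetric])
  also have "\<dots> = (\<Sum>t\<in>?T. W t * V t ^ 2) * ?lead"
    by (simp add: alternant_scale alt_y P R W_def sum_distrib_left sum_distrib_right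
          power2_eq_square prod.distrib mult_ac)
  finally have "fact m * ?D = fact m * (?S * ?lead)" using S by simp
  then show ?thesis by (simp del: fact_Suc)
qed

section \<open>Schur Q-polynomials as sums over tuples of indices\<close>

lemma inj_on_extends_to_permutation:
  assumes "finite A" "inj_on f B" "B \<subseteq> A" "f ` B \<subseteq> A"
  obtains p where "p permutes A" "\<And>x. x \<in> B \<Longrightarrow> p x = f x"
proof -
  have "card (A - B) = card (A - f ` B)"
    using assms by (simp add: card_Diff_subset finite_subset card_image)
  then obtain g where g: "bij_betw g (A - B) (A - f ` B)"
    using finite_same_card_bij assms(1) by blast
  define p where "p x = (if x \<in> B then f x else if x \<in> A then g x else x)" for x
  have "bij_betw p B (f ` B)"
    using inj_on_imp_bij_betw[OF assms(2)] by (subst bij_betw_cong[of _ _ f]) (auto simp: p_def)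
  moreover have "bij_betw p (A - B) (A - f ` B)"
    using g by (subst bij_betw_cong[of _ _ g]) (auto simp: p_def)
  ultimately have "bij_betw p (B \<union> (A - B)) (f ` B \<union> (A - f ` B))"
    by (rule bij_betw_combine) auto
  moreover have "B \<union> (A - B) = A" "f ` B \<union> (A - f ` B) = A" using assms by auto
  ultimately have "bij_betw p A A" by simp
  then have "p permutes A"
    using assms(3) by (intro bij_imp_permutes) (auto simp: p_def)
  then show ?thesis using that by (auto simp: p_def)
qed

text \<open>
  Up to the factor \<open>2 x\<^sub>k\<close> this is the residue at \<open>z = x\<^sub>k\<close> of the product of all
  \<open>(z + x\<^sub>j) / (z - x\<^sub>j)\<close>, that is of the generating function of the one-row Q-polynomials.
\<close>

definition residue_weight :: "nat \<Rightarrow> (nat \<Rightarrow> 'a::field) \<Rightarrow> nat \<Rightarrow> 'a" where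
  "residue_weight N x k = (\<Prod>j\<in>{1..N} - {k}. (x k + x j) / (x k - x j))"

text \<open>
  The defining product runs over \<open>j > i\<close>. Completing it to all \<open>j \<noteq> i\<close> gives the weight of the
  variable at position \<open>i\<close>, and the added factors with \<open>j < i\<close> are divided out again.
\<close>

lemma schur_Q_summand_permuted:
  fixes x :: "nat \<Rightarrow> 'a::field"
  assumes \<sigma>: "\<sigma> permutes {1..N}" and le: "length lam \<le> N"
    and inj: "inj_on x {1..N}"
    and nz: "\<And>i j. i \<in> {1..N} \<Longrightarrow> j \<in> {1..N} \<Longrightarrow> x i + x j \<noteq> 0"
  shows "schur_Q_summand lam N (x \<circ> \<sigma>) =
    (\<Prod>i=1..length lam. residue_weight N x (\<sigma> i) * x (\<sigma> i) ^ (lam ! (i - 1))) *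
    (\<Prod>i=1..length lam. \<Prod>j=1..<i. (x (\<sigma> i) - x (\<sigma> j)) / (x (\<sigma> i) + x (\<sigma> j)))"
proof -
  define y where "y = x \<circ> \<sigma>"
  have mem: "\<sigma> i \<in> {1..N}" if "i \<in> {1..N}" for i
    using permutes_in_image[OF \<sigma>] that by blast
  have ynz: "y i + y j \<noteq> 0" if "i \<in> {1..N}" "j \<in> {1..N}" for i j
    using nz[OF mem mem] that by (simp add: y_def)
  have yne: "y i \<noteq> y j" if "i \<in> {1..N}" "j \<in> {1..N}" "i \<noteq> j" for i j
    using inj_on_eq_iff[OF inj mem mem] that inj_eq[OF permutes_inj[OF \<sigma>]]
    by (simp add: y_def)
  have *: "(\<Prod>j=i+1..N. (y i + y j) / (y i - y j)) =
        residue_weight N x (\<sigma> i) * (\<Prod>j=1..<i. (y i - y j) / (y i + y j))"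
    if i: "i \<in> {1..length lam}" for i
  proof -
    have iN: "i \<in> {1..N}" using i le by auto
    have "residue_weight N x (\<sigma> i) =
        (\<Prod>j\<in>\<sigma> ` ({1..N} - {i}). (x (\<sigma> i) + x j) / (x (\<sigma> i) - x j))"
      unfolding residue_weight_def
      by (simp only: image_set_diff[OF permutes_inj[OF \<sigma>]] permutes_image[OF \<sigma>]) simp
    also have "\<dots> = (\<Prod>j\<in>{1..N} - {i}. (y i + y j) / (y i - y j))"
      by (subst prod.reindex) (auto simp: y_def intro: inj_on_subset[OF permutes_inj[OF \<sigma>]])
    also have "{1..N} - {i} = {1..<i} \<union> {i+1..N}" using iN by auto
    also have "(\<Prod>j\<in>\<dots>. (y i + y j) / (y i - y j)) =
        (\<Prod>j=1..<i. (y i + y j) / (y i - y j)) * (\<Prod>j=i+1..N. (y i + y j) / (y i - y j))"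
      by (rule prod.union_disjoint) auto
    finally have w: "residue_weight N x (\<sigma> i) = \<dots>" .
    have "(\<Prod>j=1..<i. (y i + y j) / (y i - y j)) * (\<Prod>j=1..<i. (y i - y j) / (y i + y j)) = 1"
      unfolding prod.distrib[symmetric]
    proof (rule prod.neutral, safe)
      fix j assume "j \<in> {1..<i}"
      then have "y i + y j \<noteq> 0" "y i - y j \<noteq> 0"
        using ynz[of i j] yne[of i j] iN by auto
      then show "(y i + y j) / (y i - y j) * ((y i - y j) / (y i + y j)) = 1" by simp
    qed
    then show ?thesis unfolding w by (simp add: mult_ac)
  qed
  have "schur_Q_summand lam N (x \<circ> \<sigma>) = (\<Prod>i=1..length lam. y i ^ (lam ! (i - 1))) *
      (\<Prod>i=1..length lam. \<Prod>j=i+1..N. (y i + y j) / (y i - y j))"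
    by (simp add: schur_Q_summand_def y_def)
  also have "\<dots> = (\<Prod>i=1..length lam. y i ^ (lam ! (i - 1))) *
      (\<Prod>i=1..length lam. residue_weight N x (\<sigma> i) * (\<Prod>j=1..<i. (y i - y j) / (y i + y j)))"
    using * by simp
  finally show ?thesis by (simp add: y_def prod.distrib mult_ac)
qed

text \<open>
  Reversing the order of the positions makes the exponents of the staircase increase with the
  position, as they do in an alternant.
\<close>

lemma prod_reversed_pairs:
  fixes h :: "nat \<Rightarrow> nat \<Rightarrow> 'a::comm_monoid_mult"
  shows "(\<Prod>i=1..m. \<Prod>j=1..<i. h i j) = (\<Prod>b<m. \<Prod>a<b. h (m - a) (m - b))"
proof -
  have "(\<Prod>i=1..m. \<Prod>j=1..<i. h i j) = (\<Prod>(i, j)\<in>(SIGMA i:{1..m}. {1..<i}). h i j)"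
    by (rule prod.Sigma) auto
  also have "\<dots> = (\<Prod>(b, a)\<in>(SIGMA b:{..<m}. {..<b}). h (m - a) (m - b))"
    by (rule prod.reindex_bij_witness[of _ "\<lambda>(b, a). (m - a, m - b)" "\<lambda>(i, j). (m - j, m - i)"])
      auto
  also have "\<dots> = (\<Prod>b<m. \<Prod>a<b. h (m - a) (m - b))"
    by (rule prod.Sigma[symmetric]) auto
  finally show ?thesis .
qed

text \<open>
  A coset of the subgroup that fixes \<open>1, \<dots>, m\<close> is the set of permutations with given values on
  \<open>1, \<dots>, m\<close>, so cosets correspond to injective tuples, here read backwards. The other tuples may
  be added because a repeated index makes one of the differences vanish.
\<close>

lemma schur_Q_eq_sum_tuples:
  fixes x :: "nat \<Rightarrow> 'a::field"
  assumes le: "length lam \<le> N"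
    and inj: "inj_on x {1..N}"
    and nz: "\<And>i j. i \<in> {1..N} \<Longrightarrow> j \<in> {1..N} \<Longrightarrow> x i + x j \<noteq> 0"
  defines "m \<equiv> length lam"
  shows "schur_Q lam N x = 2 ^ m * (\<Sum>t \<in> {0..<m} \<rightarrow>\<^sub>E {1..N}.
      (\<Prod>i=0..<m. residue_weight N x (t i) * x (t i) ^ (lam ! (m - 1 - i))) *
      (\<Prod>b<m. \<Prod>a<b. (x (t a) - x (t b)) / (x (t a) + x (t b))))"
proof -
  let ?H = "tail_perms m N" and ?L = "lcosets\<^bsub>sym_group N\<^esub> (tail_perms m N)"
  let ?T = "{0..<m} \<rightarrow>\<^sub>E {1..N}"
  interpret group "sym_group N" by (rule sym_group_is_group)
  define F where "F t = (\<Prod>i=0..<m. residue_weight N x (t i) * x (t i) ^ (lam ! (m - 1 - i))) *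
      (\<Prod>b<m. \<Prod>a<b. (x (t a) - x (t b)) / (x (t a) + x (t b)))" for t
  define rep where "rep C = (SOME \<sigma>. \<sigma> \<in> C)" for C :: "(nat \<Rightarrow> nat) set"
  define tup where "tup \<sigma> = restrict (\<lambda>i. \<sigma> (m - i)) {0..<m}" for \<sigma> :: "nat \<Rightarrow> nat"
  have coset: "\<sigma> \<in> C \<longleftrightarrow> \<sigma> permutes {1..N} \<and> (\<forall>i\<in>{1..m}. \<sigma> i = \<rho> i)"
    if C: "C = \<rho> <#\<^bsub>sym_group N\<^esub> ?H" and \<rho>: "\<rho> permutes {1..N}" for C \<sigma> \<rho>
  proof
    assume "\<sigma> \<in> C"
    then obtain \<tau> where \<tau>: "\<tau> permutes {m+1..N}" "\<sigma> = \<rho> \<circ> \<tau>"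
      by (auto simp: C l_coset_def sym_group_mult tail_perms_def)
    moreover have "\<tau> permutes {1..N}" by (rule permutes_subset[OF \<tau>(1)]) auto
    ultimately show "\<sigma> permutes {1..N} \<and> (\<forall>i\<in>{1..m}. \<sigma> i = \<rho> i)"
      using permutes_compose[OF _ \<rho>] by (simp add: permutes_not_in[OF \<tau>(1)])
  next
    assume \<sigma>: "\<sigma> permutes {1..N} \<and> (\<forall>i\<in>{1..m}. \<sigma> i = \<rho> i)"
    define \<tau> where "\<tau> = inv' \<rho> \<circ> \<sigma>"
    have "\<tau> permutes {1..N}"
      unfolding \<tau>_def using \<sigma> permutes_inv[OF \<rho>] permutes_compose by blast
    moreover have "\<tau> i = i" if "i \<in> {1..N} - {m+1..N}" for i
    proof -
      have "\<sigma> i = \<rho> i" using that \<sigma> by auto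
      then show ?thesis by (simp add: \<tau>_def permutes_inverses(2)[OF \<rho>])
    qed
    ultimately have "\<tau> permutes {m+1..N}" by (rule permutes_superset) auto
    moreover have "\<sigma> = \<rho> \<circ> \<tau>"
      by (simp add: \<tau>_def fun_eq_iff permutes_inverses[OF \<rho>])
    ultimately show "\<sigma> \<in> C"
      by (auto simp: C l_coset_def sym_group_mult tail_perms_def)
  qed
  have rep: "rep C permutes {1..N}" "C = rep C <#\<^bsub>sym_group N\<^esub> ?H" if "C \<in> ?L" for C
  proof -
    obtain \<rho> where \<rho>: "\<rho> permutes {1..N}" "C = \<rho> <#\<^bsub>sym_group N\<^esub> ?H"
      using \<open>C \<in> ?L\<close> by (auto simp: LCOSETS_def sym_group_carrier)
    have "\<rho> \<in> C" using coset[OF \<rho>(2,1)] \<rho>(1) by auto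
    then have "rep C \<in> C" unfolding rep_def by (rule someI[where P = "\<lambda>\<sigma>. \<sigma> \<in> C"])
    then have r: "rep C permutes {1..N}" "\<forall>i\<in>{1..m}. rep C i = \<rho> i"
      using coset[OF \<rho>(2,1)] by auto
    then show "rep C permutes {1..N}" by simp
    show "C = rep C <#\<^bsub>sym_group N\<^esub> ?H"
      using coset[OF \<rho>(2,1)] coset[OF refl r(1)] r(2) by auto
  qed
  have tup_eq: "tup \<sigma> = tup \<rho> \<longleftrightarrow> (\<forall>i\<in>{1..m}. \<sigma> i = \<rho> i)" for \<sigma> \<rho>
  proof
    assume eq: "tup \<sigma> = tup \<rho>"
    show "\<forall>i\<in>{1..m}. \<sigma> i = \<rho> i"
    proof
      fix i assume "i \<in> {1..m}"
      then show "\<sigma> i = \<rho> i" using fun_cong[OF eq, of "m - i"] by (simp add: tup_def)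
    qed
  qed (auto simp: tup_def intro!: restrict_ext)
  have bij: "bij_betw (\<lambda>C. tup (rep C)) ?L {t \<in> ?T. inj_on t {0..<m}}"
  proof (rule bij_betwI')
    fix C D assume C: "C \<in> ?L" and D: "D \<in> ?L"
    show "tup (rep C) = tup (rep D) \<longleftrightarrow> C = D"
      unfolding tup_eq using coset[OF rep(2,1)[OF C]] coset[OF rep(2,1)[OF D]] by auto
  next
    fix C assume C: "C \<in> ?L"
    have "rep C (m - i) \<in> {1..N}" if "i < m" for i
      using that le permutes_in_image[OF rep(1)[OF C], of "m - i"] by (auto simp: m_def)
    moreover have "inj_on (tup (rep C)) {0..<m}"
      using inj_eq[OF permutes_inj[OF rep(1)[OF C]]] by (auto simp: inj_on_def tup_def)
    ultimately show "tup (rep C) \<in> {t \<in> ?T. inj_on t {0..<m}}" by (auto simp: tup_def)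
  next
    fix t assume t: "t \<in> {t \<in> ?T. inj_on t {0..<m}}"
    have "inj_on (\<lambda>i. t (m - i)) {1..m}"
    proof (rule inj_onI)
      fix i j assume "i \<in> {1..m}" "j \<in> {1..m}" "t (m - i) = t (m - j)"
      moreover from this have "m - i = m - j" using t by (auto dest!: inj_onD)
      ultimately show "i = j" by auto
    qed
    moreover have "(\<lambda>i. t (m - i)) ` {1..m} \<subseteq> {1..N}" using t by (auto simp: PiE_iff)
    ultimately obtain \<rho> where \<rho>: "\<rho> permutes {1..N}" "\<And>i. i \<in> {1..m} \<Longrightarrow> \<rho> i = t (m - i)"
      using inj_on_extends_to_permutation[of "{1..N}" "\<lambda>i. t (m - i)" "{1..m}"] le
      by (auto simp: m_def)
    let ?C = "\<rho> <#\<^bsub>sym_group N\<^esub> ?H"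
    have C: "?C \<in> ?L" using \<rho>(1) by (auto simp: LCOSETS_def sym_group_carrier)
    have "\<rho> \<in> ?C" using coset[OF refl \<rho>(1)] \<rho>(1) by blast
    then have "tup (rep ?C) = tup \<rho>"
      unfolding tup_eq using coset[OF rep(2,1)[OF C], of \<rho>] by auto
    also have "tup \<rho> = t"
      using t \<rho>(2) by (intro extensionalityI[of _ "{0..<m}"]) (auto simp: tup_def PiE_iff)
    finally show "\<exists>C\<in>?L. t = tup (rep C)" using C by metis
  qed
  have "schur_Q_summand lam N (x \<circ> rep C) = F (tup (rep C))" if C: "C \<in> ?L" for C
  proof -
    let ?\<sigma> = "rep C"
    have "(\<Prod>i=1..m. residue_weight N x (?\<sigma> i) * x (?\<sigma> i) ^ (lam ! (i - 1))) =
        (\<Prod>i=0..<m. residue_weight N x (?\<sigma> (m - i)) * x (?\<sigma> (m - i)) ^ (lam ! (m - 1 - i)))"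
      by (rule prod.reindex_bij_witness[of _ "\<lambda>i. m - i" "\<lambda>i. m - i"]) auto
    moreover have "schur_Q_summand lam N (x \<circ> ?\<sigma>) =
        (\<Prod>i=1..m. residue_weight N x (?\<sigma> i) * x (?\<sigma> i) ^ (lam ! (i - 1))) *
        (\<Prod>i=1..m. \<Prod>j=1..<i. (x (?\<sigma> i) - x (?\<sigma> j)) / (x (?\<sigma> i) + x (?\<sigma> j)))"
      unfolding m_def by (rule schur_Q_summand_permuted[OF rep(1)[OF C] le inj]) (rule nz)
    ultimately show ?thesis
      unfolding F_def tup_def prod_reversed_pairs by simp
  qed
  then have "schur_Q lam N x = 2 ^ m * (\<Sum>C\<in>?L. F (tup (rep C)))"
    unfolding schur_Q_def by (simp add: rep_def m_def)
  also have "(\<Sum>C\<in>?L. F (tup (rep C))) = (\<Sum>t \<in> {t \<in> ?T. inj_on t {0..<m}}. F t)"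
    by (rule sum.reindex_bij_betw[OF bij])
  also have "\<dots> = (\<Sum>t\<in>?T. F t)"
  proof (rule sum.mono_neutral_left)
    show "\<forall>t\<in>?T - {t \<in> ?T. inj_on t {0..<m}}. F t = 0"
    proof
      fix t assume "t \<in> ?T - {t \<in> ?T. inj_on t {0..<m}}"
      then obtain a b where "a < b" "b < m" "t a = t b"
        unfolding inj_on_def by (auto) (metis linorder_neqE_nat)
      have "(\<Prod>a<b. (x (t a) - x (t b)) / (x (t a) + x (t b))) = 0"
        by (rule prod_zero[OF _ bexI[of _ a]]) (use \<open>a < b\<close> \<open>t a = t b\<close> in auto)
      then have "(\<Prod>b<m. \<Prod>a<b. (x (t a) - x (t b)) / (x (t a) + x (t b))) = 0"
        by (rule prod_zero[OF finite_lessThan bexI[of _ b]]) (simp add: \<open>b < m\<close>)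
      then show "F t = 0" by (simp add: F_def)
    qed
  qed (auto intro: finite_PiE)
  finally show ?thesis by (simp add: F_def)
qed

section \<open>The moments at a geometric progression\<close>

lemma q_poch_0 [simp]: "q_poch a q 0 = 1"
  by (simp add: q_poch_def)

lemma q_poch_Suc [simp]: "q_poch a q (Suc k) = q_poch a q k * (1 - a * q ^ k)"
  by (simp add: q_poch_def)

lemma q_poch_add: "q_poch a q (k + l) = q_poch a q k * q_poch (a * q ^ k) q l"
  by (induction l) (simp_all add: power_add mult_ac)

text \<open>
  Genericity makes the points \<open>q\<^sup>i\<close> pairwise distinct and, through the even powers of \<open>q\<close>, keeps
  \<open>q\<^sup>i + q\<^sup>j\<close> away from \<open>0\<close>.
\<close>

locale generic_base =
  fixes q :: "'a::field_char_0"
  assumes q_nonzero [simp]: "q \<noteq> 0"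
    and not_root: "k > 0 \<Longrightarrow> q ^ k \<noteq> 1"
begin

abbreviation qfac :: "nat \<Rightarrow> 'a" where
  "qfac \<equiv> q_poch q q"

abbreviation qneg :: "nat \<Rightarrow> 'a" where
  "qneg \<equiv> q_poch (- q) q"

lemma one_minus_power_nonzero: "1 - q * q ^ k \<noteq> 0"
  using not_root[of "Suc k"] by auto

lemma power_plus_power_nonzero: "q ^ i + q ^ j \<noteq> 0"
proof -
  have *: "1 + q ^ d \<noteq> 0" for d
  proof
    assume "1 + q ^ d = 0"
    then have "q ^ d = - 1" by (simp add: add_eq_0_iff)
    then have "q ^ (2 * d) = 1" by (simp add: mult.commute[of 2] power_mult)
    then have "d = 0" using not_root[of "2 * d"] by (cases "d = 0") auto
    with \<open>1 + q ^ d = 0\<close> show False by simp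
  qed
  show ?thesis
  proof (cases "i \<le> j")
    case True
    then have "q ^ i + q ^ j = q ^ i * (1 + q ^ (j - i))"
      by (simp add: distrib_left power_add[symmetric])
    then show ?thesis using * by simp
  next
    case False
    then have "q ^ i + q ^ j = q ^ j * (1 + q ^ (i - j))"
      by (simp add: distrib_left power_add[symmetric])
    then show ?thesis using * by simp
  qed
qed

lemma qfac_nonzero [simp]: "qfac k \<noteq> 0"
  using one_minus_power_nonzero by (auto simp: q_poch_def)

lemma inj_power: "inj (\<lambda>i. q ^ i)"
proof (rule linorder_injI)
  fix i j :: nat assume "i < j"
  then have "q ^ j = q ^ i * q ^ (j - i)" by (simp add: power_add[symmetric])
  then show "q ^ i \<noteq> q ^ j" using not_root[of "j - i"] \<open>i < j\<close> by auto
qed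

text \<open>
  By the q-binomial theorem \<open>\<Sum>\<^sub>k (c)\<^sub>k / (q)\<^sub>k z\<^sup>k\<close> stands for the infinite product
  \<open>(c z)\<^sub>\<infinity> / (z)\<^sub>\<infinity>\<close>, and \<open>(a z)\<^sub>\<infinity> / (z)\<^sub>\<infinity>\<close> times \<open>(a b z)\<^sub>\<infinity> / (a z)\<^sub>\<infinity>\<close> is \<open>(a b z)\<^sub>\<infinity> / (z)\<^sub>\<infinity>\<close>. Formally,
  infinite products are replaced by the functional equation for \<open>z \<mapsto> q z\<close> that
  characterizes them.
\<close>

lemma q_chu_vandermonde:
  "(\<Sum>k\<le>n. a ^ k * q_poch b q k / qfac k * (q_poch a q (n - k) / qfac (n - k))) =
     q_poch (a * b) q n / qfac n"
proof -
  define F where "F c d = Abs_fps (\<lambda>k. d ^ k * (q_poch c q k / qfac k))" for c d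
  define lin where "lin c = 1 - fps_const c * fps_X" for c :: 'a
  have lin_0: "fps_nth (lin c * f) 0 = fps_nth f 0"
    and lin_Suc: "fps_nth (lin c * f) (Suc k) = fps_nth f (Suc k) - c * fps_nth f k" for c f k
    by (simp_all add: lin_def left_diff_distrib mult.assoc)
  have ratio: "q_poch c q (Suc k) / qfac (Suc k) * (1 - q * q ^ k) =
      q_poch c q k / qfac k * (1 - c * q ^ k)" for c k
    using one_minus_power_nonzero[of k] by simp
  \<comment> \<open>\<open>F c d\<close> plays the part of \<open>(c d z)\<^sub>\<infinity> / (d z)\<^sub>\<infinity>\<close>.\<close>
  have F: "lin d * F c d = lin (c * d) * F c (d * q)" for c d
  proof (rule fps_ext)
    fix k show "fps_nth (lin d * F c d) k = fps_nth (lin (c * d) * F c (d * q)) k"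
    proof (cases k)
      case (Suc l)
      define u v where "u = q_poch c q (Suc l) / qfac (Suc l)" and "v = q_poch c q l / qfac l"
      have "u * (1 - q * q ^ l) = v * (1 - c * q ^ l)" unfolding u_def v_def by (rule ratio)
      then have "u - v = q * q ^ l * u - c * q ^ l * v" by (simp add: algebra_simps)
      then have "d * d ^ l * (u - v) = d * d ^ l * (q * q ^ l * u - c * q ^ l * v)" by simp
      moreover have "fps_nth (F c e) (Suc l) = e * e ^ l * u" "fps_nth (F c e) l = e ^ l * v" for e
        by (simp_all add: F_def u_def v_def del: q_poch_Suc)
      ultimately show ?thesis
        by (simp add: Suc lin_Suc power_mult_distrib algebra_simps)
    qed (simp add: lin_def F_def)
  qed
  define G where "G = F b a * F a 1"
  define H where "H = F b (a * q) * F a q"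
  have H: "fps_nth H k = q ^ k * fps_nth G k" for k
    by (auto simp: H_def G_def F_def fps_mult_nth sum_distrib_left power_mult_distrib
          power_add[symmetric] mult_ac intro!: sum.cong)
  have "lin a * (lin 1 * G) = (lin a * F b a) * (lin 1 * F a 1)" by (simp add: G_def mult_ac)
  also have "\<dots> = (lin (b * a) * F b (a * q)) * (lin a * F a q)"
    using F[of a b] F[of 1 a] by simp
  also have "\<dots> = lin a * (lin (a * b) * H)" by (simp add: H_def mult_ac)
  finally have "lin a * (lin 1 * G) = lin a * (lin (a * b) * H)" .
  moreover have "fps_nth (lin a) 0 = 1" by (simp add: lin_def)
  then have "lin a \<noteq> 0" by auto
  ultimately have GH: "lin 1 * G = lin (a * b) * H" by simp
  have G: "fps_nth G k = q_poch (a * b) q k / qfac k" for k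
  proof (induction k)
    case 0 show ?case by (simp add: G_def F_def fps_mult_nth)
  next
    case (Suc k)
    have "fps_nth G (Suc k) - fps_nth G k =
        q * q ^ k * fps_nth G (Suc k) - a * b * (q ^ k * fps_nth G k)"
      using arg_cong[OF GH, of "\<lambda>f. fps_nth f (Suc k)"] by (simp add: lin_Suc H)
    then have "fps_nth G (Suc k) * (1 - q * q ^ k) = fps_nth G k * (1 - a * b * q ^ k)"
      by (simp add: algebra_simps)
    also have "\<dots> = q_poch (a * b) q (Suc k) / qfac (Suc k) * (1 - q * q ^ k)"
      unfolding Suc.IH by (rule ratio[symmetric])
    finally show ?case by (rule mult_right_cancel[OF one_minus_power_nonzero, THEN iffD1])
  qed
  show ?thesis
    unfolding G[symmetric] by (simp add: G_def F_def fps_mult_nth atLeast0AtMost)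
qed

lemma residue_weight_powers:
  assumes "k \<le> n"
  shows "residue_weight (n + 1) (\<lambda>i. q ^ (i - 1)) (Suc k) =
    (- 1) ^ k * (qneg k / qfac k) * (qneg (n - k) / qfac (n - k))"
proof -
  define e where "e j = (q ^ k + q ^ j) / (q ^ k - q ^ j)" for j
  have "residue_weight (n + 1) (\<lambda>i. q ^ (i - 1)) (Suc k) = (\<Prod>j\<in>{..<k} \<union> {k+1..<k+1+(n-k)}. e j)"
    unfolding residue_weight_def e_def
    by (rule prod.reindex_bij_witness[of _ Suc "\<lambda>j. j - 1"]) (use assms in auto)
  also have "\<dots> = (\<Prod>j<k. e j) * (\<Prod>j=k+1..<k+1+(n-k). e j)"
    by (rule prod.union_disjoint) auto
  also have "(\<Prod>j<k. e j) = (\<Prod>s<k. e (k - Suc s))"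
    by (rule prod.nat_diff_reindex[symmetric])
  also have "\<dots> = (\<Prod>s<k. - ((1 - (- q) * q ^ s) / (1 - q * q ^ s)))"
  proof (rule prod.cong[OF refl])
    fix s assume "s \<in> {..<k}"
    then have "q ^ k = q ^ (k - Suc s) * (q * q ^ s)" by (simp add: power_add[symmetric] flip: power_Suc)
    then have "e (k - Suc s) = (q ^ (k - Suc s) * (1 - (- q) * q ^ s)) / (q ^ (k - Suc s) * - (1 - q * q ^ s))"
      unfolding e_def by (simp add: algebra_simps)
    also have "\<dots> = (1 - (- q) * q ^ s) / - (1 - q * q ^ s)" by (subst mult_divide_mult_cancel_left) auto
    finally show "e (k - Suc s) = - ((1 - (- q) * q ^ s) / (1 - q * q ^ s))" by (metis divide_minus_right)
  qed
  also have "\<dots> = (- 1) ^ k * (qneg k / qfac k)"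
    by (simp add: q_poch_def prod_dividef prod_uminus)
  also have "(\<Prod>j=k+1..<k+1+(n-k). e j) = (\<Prod>s<n-k. e (k + 1 + s))"
    by (rule prod.reindex_bij_witness[of _ "\<lambda>s. k + 1 + s" "\<lambda>j. j - (k + 1)"]) auto
  also have "\<dots> = (\<Prod>s<n-k. (1 - (- q) * q ^ s) / (1 - q * q ^ s))"
  proof (rule prod.cong[OF refl])
    fix s assume "s \<in> {..<n-k}"
    have "e (k + 1 + s) = (q ^ k * (1 - (- q) * q ^ s)) / (q ^ k * (1 - q * q ^ s))"
      unfolding e_def by (simp add: algebra_simps power_add)
    also have "\<dots> = (1 - (- q) * q ^ s) / (1 - q * q ^ s)" by (subst mult_divide_mult_cancel_left) auto
    finally show "e (k + 1 + s) = (1 - (- q) * q ^ s) / (1 - q * q ^ s)" .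
  qed
  also have "\<dots> = qneg (n - k) / qfac (n - k)"
    by (simp add: q_poch_def prod_dividef)
  finally show ?thesis by simp
qed

text \<open>
  Bases adapted to the two ends of the weight: at \<open>X = q\<^sup>k\<close> a factor of the first is
  \<open>q\<^sup>k (1 + q\<^bsup>n-k+1+s\<^esup>)\<close>, which lengthens \<open>(-q; q)\<^bsub>n-k\<^esub>\<close>, and one of the second is
  \<open>1 + q\<^bsup>k+1+s\<^esup>\<close>, which lengthens \<open>(-q; q)\<^sub>k\<close>.
\<close>

definition left_basis :: "nat \<Rightarrow> nat \<Rightarrow> 'a poly" where
  "left_basis n i = (\<Prod>s<i. [:q ^ (n + 1 + s), 1:])"

definition right_basis :: "nat \<Rightarrow> 'a poly" where
  "right_basis j = (\<Prod>s<j. [:1, q ^ (s + 1):])"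

text \<open>
  The powers of \<open>q\<^sup>k\<close> left over, \<open>i\<close> from the first basis and one from the functional, together with the
  sign of the weight form exactly the power \<open>a\<^sup>k\<close>, with \<open>a = -q\<^bsup>i+1\<^esup>\<close>, that makes the sum a
  q-Chu-Vandermonde sum.
\<close>

lemma q_hahn_moment:
  "(\<Sum>a\<in>{1..n+1}. residue_weight (n + 1) (\<lambda>i. q ^ (i - 1)) a * q ^ (a - 1) *
      poly (left_basis n i) (q ^ (a - 1)) * poly (right_basis j) (q ^ (a - 1))) =
   qneg i * qneg j * q_poch (q ^ (i + j + 2)) q n / qfac n"
proof -
  have left: "qneg (n - k) * poly (left_basis n i) (q ^ k) =
      (q ^ i) ^ k * (qneg i * q_poch (- q * q ^ i) q (n - k))" if "k \<le> n" for k
  proof -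
    have "poly (left_basis n i) (q ^ k) = (\<Prod>s<i. q ^ k * (1 - (- q * q ^ (n - k)) * q ^ s))"
      using that by (auto simp: left_basis_def poly_prod algebra_simps power_add[symmetric]
            simp flip: power_Suc intro!: prod.cong)
    also have "\<dots> = (q ^ i) ^ k * q_poch (- q * q ^ (n - k)) q i"
      by (simp add: prod.distrib q_poch_def power_mult[symmetric] mult.commute)
    finally have "qneg (n - k) * poly (left_basis n i) (q ^ k) = (q ^ i) ^ k * qneg (n - k + i)"
      by (simp add: q_poch_add mult_ac)
    also have "n - k + i = i + (n - k)" by simp
    finally show ?thesis by (simp only: q_poch_add)
  qed
  have right: "qneg k * poly (right_basis j) (q ^ k) = qneg j * q_poch (- q * q ^ j) q k" for k
  proof -
    have "poly (right_basis j) (q ^ k) = q_poch (- q * q ^ k) q j"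
      by (simp add: right_basis_def poly_prod q_poch_def mult_ac)
    then have "qneg k * poly (right_basis j) (q ^ k) = qneg (k + j)" by (simp add: q_poch_add)
    also have "k + j = j + k" by simp
    finally show ?thesis by (simp only: q_poch_add)
  qed
  have "(\<Sum>a\<in>{1..n+1}. residue_weight (n + 1) (\<lambda>i. q ^ (i - 1)) a * q ^ (a - 1) *
      poly (left_basis n i) (q ^ (a - 1)) * poly (right_basis j) (q ^ (a - 1))) =
    (\<Sum>k\<le>n. residue_weight (n + 1) (\<lambda>i. q ^ (i - 1)) (Suc k) * q ^ k *
      poly (left_basis n i) (q ^ k) * poly (right_basis j) (q ^ k))"
    by (rule sum.reindex_bij_witness[of _ Suc "\<lambda>a. a - 1"]) auto
  also have "\<dots> = (\<Sum>k\<le>n. qneg i * qneg j * ((- q * q ^ i) ^ k * q_poch (- q * q ^ j) q k / qfac k *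
      (q_poch (- q * q ^ i) q (n - k) / qfac (n - k))))"
  proof (rule sum.cong[OF refl])
    fix k assume "k \<in> {..n}"
    then have k: "k \<le> n" by simp
    have "residue_weight (n + 1) (\<lambda>i. q ^ (i - 1)) (Suc k) * q ^ k *
        poly (left_basis n i) (q ^ k) * poly (right_basis j) (q ^ k) =
      (- q) ^ k * (qneg (n - k) * poly (left_basis n i) (q ^ k)) * (qneg k * poly (right_basis j) (q ^ k)) /
        (qfac k * qfac (n - k))"
      unfolding residue_weight_powers[OF k] power_minus[of q k] by simp
    also have "\<dots> = qneg i * qneg j * ((- q * q ^ i) ^ k * q_poch (- q * q ^ j) q k / qfac k *
      (q_poch (- q * q ^ i) q (n - k) / qfac (n - k)))"
      unfolding left[OF k] right power_mult_distrib by simp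
    finally show "residue_weight (n + 1) (\<lambda>i. q ^ (i - 1)) (Suc k) * q ^ k *
        poly (left_basis n i) (q ^ k) * poly (right_basis j) (q ^ k) = \<dots>" .
  qed
  also have "\<dots> = qneg i * qneg j * (q_poch ((- q * q ^ i) * (- q * q ^ j)) q n / qfac n)"
    by (simp only: q_chu_vandermonde sum_distrib_left[symmetric])
  also have "(- q * q ^ i) * (- q * q ^ j) = q ^ (i + j + 2)"
    by (simp add: power_add power2_eq_square mult_ac)
  finally show ?thesis by simp
qed

section \<open>The determinant of the moments\<close>

lemma qfac_append: "qfac k * q_poch (q ^ (k + 1)) q l = qfac (k + l)"
  by (simp add: q_poch_add)

text \<open>
  Up to a factor depending on the row \<open>i\<close> only, \<open>(q\<^bsup>i+j+2\<^esup>; q)\<^sub>n\<close> is the value of this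
  polynomial at \<open>q\<^sup>i\<close>: from column \<open>j\<close> to column \<open>j + 1\<close> one factor at the lower end of the
  q-shifted factorial is exchanged for one at its upper end.
\<close>

definition column_poly :: "nat \<Rightarrow> nat \<Rightarrow> nat \<Rightarrow> 'a poly" where
  "column_poly n m j =
     (\<Prod>s<m-1. [:1, - (if s < j then q ^ (n + 2 + s) else q ^ (2 + s)):])"

lemma poly_column_poly:
  assumes "j < m"
  shows "poly (column_poly n m j) z =
    q_poch (q ^ (n + 2) * z) q j * q_poch (q ^ (j + 2) * z) q (m - 1 - j)"
proof -
  have split: "(\<Prod>s<k+l. if s < k then u s else v s) = (\<Prod>s<k. u s) * (\<Prod>s<l. v (k + s))"
    for k l and u v :: "nat \<Rightarrow> 'a"
    by (induction l) (simp_all add: mult_ac)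
  have "poly (column_poly n m j) z =
      (\<Prod>s<j+(m-1-j). if s < j then 1 - q ^ (n + 2) * z * q ^ s else 1 - q ^ 2 * z * q ^ s)"
    using assms by (auto simp: column_poly_def poly_prod power_add power2_eq_square mult_ac
          intro!: prod.cong)
  then show ?thesis
    unfolding split by (simp add: q_poch_def power_add power2_eq_square mult_ac)
qed

text \<open>
  The coefficient determinant of the column polynomials is found by evaluating them at
  \<open>q\<^bsup>-i-1\<^esup>\<close>, where those with \<open>j < i\<close> vanish. The ratio of the Vandermonde
  determinants at \<open>q\<^sup>i\<close> and at \<open>q\<^bsup>-i-1\<^esup>\<close> is a monomial in \<open>q\<close> up to sign, so no
  Vandermonde product has to be evaluated.
\<close>

lemma det_shifted_q_poch:
  assumes "m \<le> n + 1"
  shows "det (mat m m (\<lambda>(i, j). q_poch (q ^ (i + j + 2)) q n)) =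
    (\<Prod>i<m. qfac (n + 1 + i) / qfac (i + m)) * (\<Prod>b<m. \<Prod>a<b. - (q ^ (1 + a + b))) *
    (\<Prod>i<m. qfac n / qfac (n - i) * qfac (m - 1 - i))"
proof -
  let ?f = "column_poly n m"
  let ?X = "\<lambda>i. inverse (q ^ (i + 1))"
  have entry: "q_poch (q ^ (i + j + 2)) q n = qfac (n + 1 + i) / qfac (i + m) * poly (?f j) (q ^ i)"
    if "j < m" for i j
  proof -
    have a: "q ^ (n + 2) * q ^ i = q ^ (n + 1 + i + 1)" and b: "q ^ (j + 2) * q ^ i = q ^ (i + j + 1 + 1)"
      by (simp_all add: power_add[symmetric] add_ac)
    have "qfac (i + j + 1) * (qfac (n + 1 + i) * poly (?f j) (q ^ i)) =
        (qfac (n + 1 + i) * q_poch (q ^ (n + 1 + i + 1)) q j) *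
        (qfac (i + j + 1) * q_poch (q ^ (i + j + 1 + 1)) q (m - 1 - j))"
      unfolding poly_column_poly[OF that] a b by (simp only: mult_ac)
    also have "\<dots> = qfac (n + 1 + i + j) * qfac (i + j + 1 + (m - 1 - j))"
      by (simp only: qfac_append)
    also have "i + j + 1 + (m - 1 - j) = i + m" using that by simp
    also have "n + 1 + i + j = i + j + 1 + n" by simp
    also have "qfac (i + j + 1 + n) = qfac (i + j + 1) * q_poch (q ^ (i + j + 1 + 1)) q n"
      by (rule qfac_append[symmetric])
    finally have "qfac (n + 1 + i) * poly (?f j) (q ^ i) = q_poch (q ^ (i + j + 2)) q n * qfac (i + m)"
      by (simp del: q_poch_Suc)
    then show ?thesis by (simp add: field_simps del: q_poch_Suc)
  qed
  have deg: "degree (?f j) < m" if "j < m" for j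
    using that unfolding column_poly_def
    by (intro le_less_trans[OF degree_coeff_prod_linear(1)]) simp
  let ?K = "det (mat m m (\<lambda>(i, j). coeff (?f j) i))"
  have vand: "alternant m (\<lambda>j z. z ^ j) (\<lambda>i. q ^ i) =
      (\<Prod>b<m. \<Prod>a<b. - (q ^ (1 + a + b))) * alternant m (\<lambda>j z. z ^ j) ?X"
  proof -
    have "q ^ b - q ^ a = - (q ^ (1 + a + b)) * (inverse (q ^ (b + 1)) - inverse (q ^ (a + 1)))" for a b
      by (simp add: field_simps power_add)
    then show ?thesis unfolding vandermonde prod.distrib[symmetric] by simp
  qed
  have diag: "alternant m (\<lambda>j. poly (?f j)) ?X = (\<Prod>i<m. poly (?f i) (?X i))"
  proof (rule alternant_upper_triangular)
    fix i j :: nat assume "j < i" "i < m"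
    \<comment> \<open>the vanishing factor of the second q-shifted factorial has index \<open>i - 1 - j\<close>\<close>
    have "q ^ (j + 2) * ?X i * q ^ (i - 1 - j) = 1"
    proof -
      have "q ^ (j + 2) * q ^ (i - 1 - j) = q ^ (i + 1)"
        using \<open>j < i\<close> by (simp add: power_add[symmetric] del: power_Suc)
      then show ?thesis by (simp add: field_simps)
    qed
    then have "q_poch (q ^ (j + 2) * ?X i) q (m - 1 - j) = 0"
      unfolding q_poch_def using \<open>j < i\<close> \<open>i < m\<close>
      by (intro prod_zero[OF _ bexI[of _ "i - 1 - j"]]) auto
    then show "poly (?f j) (?X i) = 0"
      using \<open>j < i\<close> \<open>i < m\<close> by (simp add: poly_column_poly)
  qed
  have diag_entry: "poly (?f i) (?X i) = qfac n / qfac (n - i) * qfac (m - 1 - i)" if "i < m" for i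
  proof -
    have i: "i \<le> n" using that assms by simp
    have "q ^ (n + 2) = q ^ (n - i + 1) * q ^ (i + 1)"
      using i by (simp add: power_add[symmetric] del: power_Suc)
    then have "q ^ (n + 2) * ?X i = q ^ (n - i + 1) * (q ^ (i + 1) * ?X i)"
      by (simp only: mult.assoc)
    also have "q ^ (i + 1) * ?X i = 1" by (rule right_inverse) simp
    finally have "q ^ (n + 2) * ?X i = q ^ (n - i + 1)" by (simp only: mult_1_right)
    moreover have "q ^ (i + 2) * ?X i = q" by (simp add: field_simps)
    moreover have "q_poch (q ^ (n - i + 1)) q i = qfac n / qfac (n - i)"
      using qfac_append[of "n - i" i] i by (simp add: field_simps)
    ultimately show ?thesis unfolding poly_column_poly[OF that] by (simp only:)
  qed
  have "det (mat m m (\<lambda>(i, j). q_poch (q ^ (i + j + 2)) q n)) =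
      alternant m (\<lambda>j i. qfac (n + 1 + i) / qfac (i + m) * poly (?f j) (q ^ i)) id"
    unfolding alternant_def
    by (rule arg_cong[of _ _ det], rule cong_mat) (simp_all only: entry id_apply prod.case)
  also have "\<dots> = (\<Prod>i=0..<m. qfac (n + 1 + id i) / qfac (id i + m)) *
      alternant m (\<lambda>j i. poly (?f j) (q ^ i)) id"
    by (rule alternant_scale)
  also have "alternant m (\<lambda>j i. poly (?f j) (q ^ i)) id = alternant m (\<lambda>j. poly (?f j)) (\<lambda>i. q ^ i)"
    by (simp add: alternant_def)
  also have "\<dots> = alternant m (\<lambda>j z. z ^ j) (\<lambda>i. q ^ i) * ?K"
    by (rule alternant_poly[OF deg])
  also have "\<dots> = (\<Prod>b<m. \<Prod>a<b. - (q ^ (1 + a + b))) * (alternant m (\<lambda>j z. z ^ j) ?X * ?K)"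
    unfolding vand by (simp only: mult_ac)
  also have "alternant m (\<lambda>j z. z ^ j) ?X * ?K = alternant m (\<lambda>j. poly (?f j)) ?X"
    by (rule alternant_poly[OF deg, symmetric])
  also have "\<dots> = (\<Prod>i<m. qfac n / qfac (n - i) * qfac (m - 1 - i))"
    unfolding diag by (rule prod.cong[OF refl], rule diag_entry) simp
  finally show ?thesis by (simp add: atLeast0LessThan mult_ac)
qed

abbreviation qodd :: "nat \<Rightarrow> 'a" where
  "qodd \<equiv> q_poch q (q ^ 2)"

lemma qodd_nonzero [simp]: "qodd k \<noteq> 0"
proof -
  have "1 - q * (q ^ 2) ^ j \<noteq> 0" for j
    using one_minus_power_nonzero[of "2 * j"] by (simp add: power_mult)
  then show ?thesis by (auto simp: q_poch_def)
qed

lemma qfac_double: "qneg k * qfac k * qodd k = qfac (2 * k)"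
proof (induction k)
  case (Suc k)
  have "qneg (Suc k) * qfac (Suc k) * qodd (Suc k) =
      (qneg k * qfac k * qodd k) * ((1 - q * q ^ (2 * k)) * (1 - q * q ^ Suc (2 * k)))"
    by (simp add: power_mult power2_eq_square power_mult_distrib algebra_simps)
  then show ?case unfolding Suc.IH by simp
qed simp

lemma qfac_double_Suc: "qneg k * qfac k * qodd (Suc k) = qfac (Suc (2 * k))"
  unfolding q_poch_Suc qfac_double[symmetric] by (simp add: mult_ac flip: power_mult)

text \<open>
  Passing from \<open>m\<close> to \<open>m + 1\<close> drops \<open>(q)\<^sub>m\<close> from the right side and adds \<open>(q)\<^bsub>2m\<^esub> (q)\<^bsub>2m+1\<^esub>\<close>, and both
  of these split off their odd factors.
\<close>

lemma prod_qfac_window: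
  "(\<Prod>i<m. qneg i ^ 2 * qfac i) * (\<Prod>i<m. qodd i * qodd (Suc i)) = (\<Prod>i<m. qfac (i + m))"
proof (induction m)
  case (Suc m)
  have "qfac m * (\<Prod>i<Suc m. qfac (i + Suc m)) = (\<Prod>i<Suc (Suc m). qfac (i + m))"
    by (subst prod.lessThan_Suc_shift) simp
  also have "\<dots> = (\<Prod>i<m. qfac (i + m)) * qfac (2 * m) * qfac (Suc (2 * m))"
    by (simp add: mult_2 del: q_poch_Suc)
  also have "\<dots> = qfac m * ((\<Prod>i<Suc m. qneg i ^ 2 * qfac i) * (\<Prod>i<Suc m. qodd i * qodd (Suc i)))"
    unfolding Suc.IH[symmetric] qfac_double[symmetric] qfac_double_Suc[symmetric]
    by (simp add: power2_eq_square mult_ac del: q_poch_Suc)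
  finally show ?case by simp
qed simp

text \<open>
  The second factor on the right is the product of the leading coefficients of the second basis;
  the first one is the power of \<open>q\<close> in the final formula.
\<close>

lemma prod_q_pow_pairs:
  "(\<Prod>b<m. \<Prod>a<b. q ^ (1 + a + b)) = q ^ (\<Sum>k<m. k ^ 2) * (\<Prod>j<m. \<Prod>s<j. q ^ (s + 1))"
proof (induction m)
  case (Suc m)
  have "(\<Prod>a<m. q ^ (1 + a + m)) = (\<Prod>s<m. q ^ (s + 1)) * q ^ (m ^ 2)"
    by (simp add: power_add prod.distrib power_mult[symmetric] power2_eq_square mult_ac)
  then show ?case using Suc by (simp add: power_add mult_ac)
qed simp

lemma schur_Q_odd_staircase_principal:
  assumes mn: "m \<le> n + 1" and len: "length lam = m"
    and odd: "\<And>i. i < m \<Longrightarrow> lam ! (m - 1 - i) = 2 * i + 1"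
  shows "schur_Q lam (n + 1) (\<lambda>i. q ^ (i - 1)) =
    2 ^ m * q ^ (\<Sum>k<m. k ^ 2) *
    (\<Prod>i<m. qfac (n + 1 + i) / qfac (n - i) / (qodd i * qodd (Suc i)))"
proof -
  let ?x = "\<lambda>i. q ^ (i - 1)" and ?A = "{1..n+1}"
  let ?c = "residue_weight (n + 1) ?x"
  define \<epsilon> :: 'a where "\<epsilon> = (\<Prod>b<m. \<Prod>a<b. - 1)"
  have \<epsilon>: "\<epsilon> * \<epsilon> = 1" by (simp add: \<epsilon>_def prod.distrib[symmetric])
  define T where "T = (\<Sum>t \<in> {0..<m} \<rightarrow>\<^sub>E ?A. (\<Prod>i=0..<m. ?c (t i) * ?x (t i) ^ (2 * i + 1)) *
            (\<Prod>b<m. \<Prod>a<b. (?x (t b) - ?x (t a)) / (?x (t b) + ?x (t a))))"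
  \<comment> \<open>the leading coefficients of the second basis; the first basis is monic\<close>
  define lead where "lead = (\<Prod>j<m. \<Prod>s<j. q ^ (s + 1))"
  have lead0: "lead \<noteq> 0" by (simp add: lead_def)
  have "inj_on ?x ?A"
  proof (rule inj_onI)
    fix i j assume "i \<in> ?A" "j \<in> ?A" "?x i = ?x j"
    then show "i = j" using injD[OF inj_power, of "i - 1" "j - 1"] by auto
  qed
  then have "schur_Q lam (n + 1) ?x = 2 ^ m * (\<Sum>t \<in> {0..<m} \<rightarrow>\<^sub>E ?A.
      (\<Prod>i=0..<m. ?c (t i) * ?x (t i) ^ (lam ! (m - 1 - i))) *
      (\<Prod>b<m. \<Prod>a<b. (?x (t a) - ?x (t b)) / (?x (t a) + ?x (t b))))"
    using schur_Q_eq_sum_tuples[of lam "n + 1" ?x] mn len power_plus_power_nonzero by simp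
  also have "\<dots> = 2 ^ m * (\<Sum>t \<in> {0..<m} \<rightarrow>\<^sub>E ?A.
      (\<Prod>i=0..<m. ?c (t i) * ?x (t i) ^ (2 * i + 1)) *
      (\<epsilon> * (\<Prod>b<m. \<Prod>a<b. (?x (t b) - ?x (t a)) / (?x (t b) + ?x (t a)))))"
  proof -
    have "(\<Prod>b<m. \<Prod>a<b. (?x (t a) - ?x (t b)) / (?x (t a) + ?x (t b))) =
        \<epsilon> * (\<Prod>b<m. \<Prod>a<b. (?x (t b) - ?x (t a)) / (?x (t b) + ?x (t a)))" for t :: "nat \<Rightarrow> nat"
    proof -
      have flip: "(u - v) / (u + v) = - 1 * ((v - u) / (v + u))" for u v :: 'a
        by (simp add: add.commute[of v u] minus_divide_left)
      show ?thesis unfolding \<epsilon>_def prod.distrib[symmetric] by (simp only: flip[symmetric])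
    qed
    then show ?thesis using odd by simp
  qed
  also have "\<dots> = 2 ^ m * (\<epsilon> * T)"
    by (simp add: T_def sum_distrib_left mult_ac)
  finally have Q: "schur_Q lam (n + 1) ?x = 2 ^ m * (\<epsilon> * T)" .
  have "T * lead = det (mat m m (\<lambda>(i, j). \<Sum>a\<in>?A. ?c a * ?x a *
      poly (left_basis n i) (?x a) * poly (right_basis j) (?x a)))"
    using odd_staircase_sum_eq_det[of ?A ?x m "left_basis n" right_basis ?c]
    by (simp add: T_def lead_def left_basis_def right_basis_def power_plus_power_nonzero
          degree_coeff_prod_linear)
  also have "\<dots> = det (mat m m (\<lambda>(i, j). qneg i * qneg j * q_poch (q ^ (i + j + 2)) q n / qfac n))"
    by (simp only: q_hahn_moment)
  also have "\<dots> = (\<Prod>i<m. qneg i) * (\<Prod>j<m. qneg j / qfac n) *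
      det (mat m m (\<lambda>(i, j). q_poch (q ^ (i + j + 2)) q n))"
    using det_scale_rows_cols[of m qneg "\<lambda>j. qneg j / qfac n"] by simp
  also have "\<dots> = (\<Prod>i<m. qneg i) * (\<Prod>j<m. qneg j / qfac n) *
      ((\<Prod>i<m. qfac (n + 1 + i) / qfac (i + m)) * (\<epsilon> * (q ^ (\<Sum>k<m. k ^ 2) * lead)) *
      ((\<Prod>i<m. qfac n / qfac (n - i)) * (\<Prod>i<m. qfac i)))"
  proof -
    have "(\<Prod>b<m. \<Prod>a<b. - (q ^ (1 + a + b))) = \<epsilon> * (\<Prod>b<m. \<Prod>a<b. q ^ (1 + a + b))"
      unfolding \<epsilon>_def prod.distrib[symmetric] by simp
    then have signs: "(\<Prod>b<m. \<Prod>a<b. - (q ^ (1 + a + b))) = \<epsilon> * (q ^ (\<Sum>k<m. k ^ 2) * lead)"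
      unfolding prod_q_pow_pairs lead_def .
    have "(\<Prod>i<m. qfac (m - 1 - i)) = (\<Prod>i<m. qfac i)"
      using prod.nat_diff_reindex[of qfac m] by simp
    then show ?thesis
      unfolding det_shifted_q_poch[OF mn] signs prod.distrib by simp
  qed
  also have "\<dots> = (\<epsilon> * q ^ (\<Sum>k<m. k ^ 2) * ((\<Prod>i<m. qneg i ^ 2 * qfac i) / (\<Prod>i<m. qfac (i + m))) *
      (\<Prod>i<m. qfac (n + 1 + i) / qfac (n - i))) * lead"
    by (simp add: prod.distrib prod_dividef power2_eq_square mult_ac)
  finally have "T = \<epsilon> * q ^ (\<Sum>k<m. k ^ 2) * ((\<Prod>i<m. qneg i ^ 2 * qfac i) / (\<Prod>i<m. qfac (i + m))) *
      (\<Prod>i<m. qfac (n + 1 + i) / qfac (n - i))"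
    by (rule mult_right_cancel[OF lead0, THEN iffD1])
  also have "(\<Prod>i<m. qneg i ^ 2 * qfac i) / (\<Prod>i<m. qfac (i + m)) =
      1 / (\<Prod>i<m. qodd i * qodd (Suc i))"
  proof -
    have "(\<Prod>i<m. qfac (i + m)) \<noteq> 0" "(\<Prod>i<m. qodd i * qodd (Suc i)) \<noteq> 0"
      by (simp_all del: q_poch_Suc)
    then show ?thesis
      using prod_qfac_window[of m] by (simp add: frac_eq_eq del: q_poch_Suc)
  qed
  finally have "\<epsilon> * T = (\<epsilon> * \<epsilon>) * q ^ (\<Sum>k<m. k ^ 2) *
      (\<Prod>i<m. qfac (n + 1 + i) / qfac (n - i) / (qodd i * qodd (Suc i)))"
    by (simp add: prod_dividef prod.distrib mult_ac del: q_poch_Suc)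
  then show ?thesis unfolding Q \<epsilon> by (simp only: mult_1_left mult.assoc)
qed

end

lemma twice_choose_three_div_four: "((2 * m) choose 3) div 4 = (\<Sum>k<m. k ^ 2)"
proof -
  have two: "2 * ((2 * k) choose 2) + 2 * k = 4 * k ^ 2" for k :: nat
    by (cases k) (simp_all add: choose_two power2_eq_square algebra_simps)
  have "(2 * m) choose 3 = 4 * (\<Sum>k<m. k ^ 2)"
  proof (induction m)
    case (Suc m)
    have "(2 * Suc m) choose 3 = ((2 * m) choose 3) + (2 * ((2 * m) choose 2) + 2 * m)"
      by (simp add: numeral_3_eq_3 numeral_2_eq_2)
    then show ?case using Suc two[of m] by simp
  qed simp
  then show ?thesis by simp
qed

theorem proposition4p1:
  fixes q :: complex and m n :: nat and lam :: "nat list"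
  assumes "q \<noteq> 0"
    and "\<forall>k::nat. k > 0 \<longrightarrow> q ^ k \<noteq> 1"
    and "m \<ge> 1"
    and "n \<ge> m - 1"
    and "lam = map (\<lambda>i. 2 * m - 2 * i + 1) [1..<m + 1]"
  shows "schur_Q lam (n + 1) (\<lambda>i. q ^ (i - 1)) =
    2 ^ m * q ^ (((2 * m) choose 3) div 4) *
    (\<Prod>i=1..m. q_poch (q ^ (n + 1 - m + i)) q m /
       (q_poch q (q ^ 2) (i - 1) * q_poch q (q ^ 2) i))"
proof -
  interpret generic_base q using assms(1,2) by unfold_locales auto
  have mn: "m \<le> n + 1" using assms(4) by simp
  have "(\<Prod>i=1..m. q_poch (q ^ (n + 1 - m + i)) q m) = (\<Prod>i=1..m. qfac (n + i) / qfac (n + i - m))"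
  proof (rule prod.cong[OF refl])
    fix i assume "i \<in> {1..m}"
    then have "n + 1 - m + i = (n + i - m) + 1" "(n + i - m) + m = n + i" using mn by auto
    then show "q_poch (q ^ (n + 1 - m + i)) q m = qfac (n + i) / qfac (n + i - m)"
      using qfac_append[of "n + i - m" m] by (simp add: field_simps del: q_poch_Suc)
  qed
  also have "\<dots> = (\<Prod>i<m. qfac (n + 1 + i)) / (\<Prod>i<m. qfac (n - i))"
  proof -
    have "(\<Prod>i=1..m. qfac (n + i)) = (\<Prod>i<m. qfac (n + 1 + i))"
      by (rule prod.reindex_bij_witness[of _ Suc "\<lambda>i. i - 1"]) auto
    moreover have "(\<Prod>i=1..m. qfac (n + i - m)) = (\<Prod>i<m. qfac (n - i))"
      by (rule prod.reindex_bij_witness[of _ "\<lambda>i. m - i" "\<lambda>i. m - i"]) auto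
    ultimately show ?thesis by (simp add: prod_dividef)
  qed
  finally have num: "(\<Prod>i=1..m. q_poch (q ^ (n + 1 - m + i)) q m) = \<dots>" .
  have den: "(\<Prod>i=1..m. qodd (i - 1) * qodd i) = (\<Prod>i<m. qodd i * qodd (Suc i))"
    by (rule prod.reindex_bij_witness[of _ Suc "\<lambda>i. i - 1"]) auto
  have "length lam = m" "\<And>i. i < m \<Longrightarrow> lam ! (m - 1 - i) = 2 * i + 1"
    using assms(5) by (auto simp: nth_map simp del: upt_Suc)
  from schur_Q_odd_staircase_principal[OF mn this] show ?thesis
    unfolding twice_choose_three_div_four prod_dividef num den by simp
qed

end
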